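(* Let $G$ be a finite simple cubic graph, let $H$ be the hexagon graph of $G$, let $M$ be a blue perfect matching of $H$, and let $W$ be the set of white edges of $H$. The embedding of $G$ encoded by $M$ has a dual loop if and only if there is a cycle in $M\Delta W$ that contains both end vertices of some red edge of $H$.
   Context: **Hexagon graph.** Let $G$ be a finite simple cubic graph with vertex set $V$ and edge set $E$. A hexagon graph $H$ of $G$ is built as follows. (1) Each $v\in V$ is replaced by a copy $h_v$ of $K_{3,3}$ (a "hexagon"), the $h_v$ being pairwise vertex disjoint, with $V(H)=\bigcup_{v\in V}V(h_v)$. (2) For each $v$, write $V(h_v)=\{v_i: i\in\mathbb{Z}_6\}$ and $E(h_v)=\{v_iv_{i+1},\,v_iv_{i+3}: i\in\mathbb{Z}_6\}$. To each neighbour $u$ of $v$ in $G$ assign an index $i_{v(u)}\in\{0,1,2\}\subset\mathbb{Z}_6$ so that the three neighbours of $v$ get pairwise distinct indices. (3) Let $X=\bigcup_{v\in V}\{v_0,v_2,v_4\}$ and $Y=\bigcup_{v\in V}\{v_1,v_3,v_5\}$. Each edge $uv\in E$ is replaced by two vertex disjoint edges $e_{uv},e'_{uv}$: if $v_{i_{v(u)}}$ and $u_{i_{u(v)}}$ both belong to $X$ or both belong to $Y$, then $e_{uv}=v_{i_{v(u)}}u_{i_{u(v)}+3}$ and $e'_{uv}=v_{i_{v(u)}+3}u_{i_{u(v)}}$; otherwise $e_{uv}=v_{i_{v(u)}}u_{i_{u(v)}}$ and $e'_{uv}=v_{i_{v(u)}+3}u_{i_{u(v)}+3}$. Finally $E(H)=\bigcup_{v\in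 V}E(h_v)\cup\{e_{uv},e'_{uv}:uv\in E\}$. All hexagon graphs of $G$ are isomorphic, so one speaks of the hexagon graph of $G$. **Colours.** Edges $v_iv_{i+3}$ are red, edges $v_iv_{i+1}$ are blue, and edges $e_{uv},e'_{uv}$ are white. The set $W$ of white edges is a perfect matching of $H$. A blue perfect matching is a perfect matching of $H$ containing only blue edges. For a blue perfect matching $M$, $M\Delta W=M\cup W$ is a disjoint union of cycles. **Embedding encoded by $M$.** Embeddings of $G$ on closed orientable surfaces are represented by rotation systems $\pi=\{\pi_v:v\in V\}$, where $\pi_v$ is a cyclic permutation of the edges incident with $v$. The faces of $\pi$ are the closed walks $e_1e_2\cdots e_k$ with $e_i=v^iv^{i+1}\in E$ (traversed from $v^i$ to $v^{i+1}$), $\pi_{v^{i+1}}(e_i)=e_{i+1}$, closing up with $e_{k+1}=e_1$ (traversed in the same direction), $k$ minimal. A blue perfect matching $M$ encodes the embedding with the following rotation system: for $v\in V$ with neighbours $u,w,z$ such that $i_{v(u)}=0$, $i_{v(w)}=1$, $i_{v(z)}=2$, the restriction of $M$ to $h_v$ is either $\{v_0v_1,v_2v_3,v_4v_5\}$, in which case $\pi_v=(uv\ wv\ zv)$, or $\{v_1v_2,v_3v_4,v_5v_0\}$, in which case $\pi_v=(uv\ zv\ wv)$. **Dual loop.** An embedding has a dual loop if some edge of $G$ belongs to exactly one face boundary (equivalently, both traversal directions of the edge occur in the same face), rather than to two distinct face boundaries. *)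

theory Defs
  imports Complex_Main "HOL-Library.Numeral_Type" "HOL-Combinatorics.Cycles"
begin

section \<open>Finite simple graphs\<close>

record 'a ugraph =
  verts :: "'a set"
  edges :: "'a set set"

definition finite_simple_graph :: "'a ugraph \<Rightarrow> bool" where
  "finite_simple_graph G \<longleftrightarrow>
     finite (verts G) \<and> (\<forall>e\<in>edges G. e \<subseteq> verts G \<and> card e = 2)"

definition incident :: "'a ugraph \<Rightarrow> 'a \<Rightarrow> 'a set set" where
  "incident G v = {e \<in> edges G. v \<in> e}"

definition neighbours :: "'a ugraph \<Rightarrow> 'a \<Rightarrow> 'a set" where
  "neighbours G v = {u. {u, v} \<in> edges G}"

definition cubic :: "'a ugraph \<Rightarrow> bool" where
  "cubic G \<longleftrightarrow> (\<forall>v\<in>verts G. card (incident G v) = 3)"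

definition perfect_matching :: "'a ugraph \<Rightarrow> 'a set set \<Rightarrow> bool" where
  "perfect_matching G M \<longleftrightarrow> M \<subseteq> edges G \<and> (\<forall>x\<in>verts G. \<exists>!e\<in>M. x \<in> e)"

text \<open>A cycle using only edges of the set F, given by the cyclic list of its vertices.\<close>

definition cycle_in :: "'a set set \<Rightarrow> 'a list \<Rightarrow> bool" where
  "cycle_in F xs \<longleftrightarrow> length xs \<ge> 3 \<and> distinct xs \<and>
     (\<forall>i<length xs. {xs ! i, xs ! (Suc i mod length xs)} \<in> F)"


section \<open>Rotation systems, faces and dual loops\<close>

definition rotation_system :: "'a ugraph \<Rightarrow> ('a \<Rightarrow> 'a set \<Rightarrow> 'a set) \<Rightarrow> bool" where
  "rotation_system G \<pi> \<longleftrightarrow>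
     (\<forall>v\<in>verts G. \<exists>es. distinct es \<and> set es = incident G v \<and> \<pi> v = cycle_of_list es)"

text \<open>
  A traversal of the edge xy from x to y is the pair (x, y). A face walk is the list of its
  traversals; the last conjunct says that the walk is stopped at the first return of its
  initial traversal.
\<close>

definition face_walk :: "'a ugraph \<Rightarrow> ('a \<Rightarrow> 'a set \<Rightarrow> 'a set) \<Rightarrow> ('a \<times> 'a) list \<Rightarrow> bool" where
  "face_walk G \<pi> ds \<longleftrightarrow> ds \<noteq> [] \<and>
     (\<forall>i<length ds.
        let (x, y) = ds ! i; (x', y') = ds ! (Suc i mod length ds)
        in {x, y} \<in> edges G \<and> x' = y \<and> \<pi> y {x, y} = {x', y'}) \<and>
     (\<forall>i<length ds. i > 0 \<longrightarrow> ds ! i \<noteq> ds ! 0)"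

text \<open>A face is a face walk up to the choice of its starting point.\<close>

definition faces :: "'a ugraph \<Rightarrow> ('a \<Rightarrow> 'a set \<Rightarrow> 'a set) \<Rightarrow> ('a \<times> 'a) list set set" where
  "faces G \<pi> = {{rotate n ds |n. True} |ds. face_walk G \<pi> ds}"

definition on_face_boundary :: "'a set \<Rightarrow> ('a \<times> 'a) list set \<Rightarrow> bool" where
  "on_face_boundary e f \<longleftrightarrow> (\<exists>ds\<in>f. \<exists>(x, y)\<in>set ds. e = {x, y})"

definition has_dual_loop :: "'a ugraph \<Rightarrow> ('a \<Rightarrow> 'a set \<Rightarrow> 'a set) \<Rightarrow> bool" where
  "has_dual_loop G \<pi> \<longleftrightarrow> (\<exists>e\<in>edges G. \<exists>!f\<in>faces G \<pi>. on_face_boundary e f)"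


section \<open>Hexagon graphs\<close>

text \<open>
  The vertex written v with subscript i is the pair (v, i), where i ranges over the type 6
  of integers modulo 6. The index that v assigns to its neighbour u is \<open>idx v u\<close>.
\<close>

definition hexagon_indexing :: "'a ugraph \<Rightarrow> ('a \<Rightarrow> 'a \<Rightarrow> 6) \<Rightarrow> bool" where
  "hexagon_indexing G idx \<longleftrightarrow>
     (\<forall>v\<in>verts G. idx v ` neighbours G v \<subseteq> {0, 1, 2} \<and> inj_on (idx v) (neighbours G v))"

definition hex_blue :: "'a \<Rightarrow> ('a \<times> 6) set set" where
  "hex_blue v = {{(v, i), (v, i + 1)} |i. True}"

definition hex_red :: "'a \<Rightarrow> ('a \<times> 6) set set" where
  "hex_red v = {{(v, i), (v, i + 3)} |i. True}"

definition side_X :: "'a ugraph \<Rightarrow> ('a \<times> 6) set" where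
  "side_X G = (\<Union>v\<in>verts G. {(v, 0), (v, 2), (v, 4)})"

definition side_Y :: "'a ugraph \<Rightarrow> ('a \<times> 6) set" where
  "side_Y G = (\<Union>v\<in>verts G. {(v, 1), (v, 3), (v, 5)})"

definition white_pair :: "'a ugraph \<Rightarrow> ('a \<Rightarrow> 'a \<Rightarrow> 6) \<Rightarrow> 'a \<Rightarrow> 'a \<Rightarrow> ('a \<times> 6) set set" where
  "white_pair G idx u v =
     (let i = idx v u; j = idx u v in
      if {(v, i), (u, j)} \<subseteq> side_X G \<or> {(v, i), (u, j)} \<subseteq> side_Y G
      then {{(v, i), (u, j + 3)}, {(v, i + 3), (u, j)}}
      else {{(v, i), (u, j)}, {(v, i + 3), (u, j + 3)}})"

definition blue_edges :: "'a ugraph \<Rightarrow> ('a \<times> 6) set set" where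
  "blue_edges G = (\<Union>v\<in>verts G. hex_blue v)"

definition red_edges :: "'a ugraph \<Rightarrow> ('a \<times> 6) set set" where
  "red_edges G = (\<Union>v\<in>verts G. hex_red v)"

definition white_edges :: "'a ugraph \<Rightarrow> ('a \<Rightarrow> 'a \<Rightarrow> 6) \<Rightarrow> ('a \<times> 6) set set" where
  "white_edges G idx = \<Union>{white_pair G idx u v |u v. {u, v} \<in> edges G}"

definition hexagon_graph :: "'a ugraph \<Rightarrow> ('a \<Rightarrow> 'a \<Rightarrow> 6) \<Rightarrow> ('a \<times> 6) ugraph" where
  "hexagon_graph G idx =
     \<lparr>verts = verts G \<times> UNIV,
      edges = blue_edges G \<union> red_edges G \<union> white_edges G idx\<rparr>"

definition blue_perfect_matching ::
    "'a ugraph \<Rightarrow> ('a \<Rightarrow> 'a \<Rightarrow> 6) \<Rightarrow> ('a \<times> 6) set set \<Rightarrow> bool" where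
  "blue_perfect_matching G idx M \<longleftrightarrow>
     perfect_matching (hexagon_graph G idx) M \<and> M \<subseteq> blue_edges G"


section \<open>The embedding encoded by a blue perfect matching\<close>

text \<open>The edge joining v to its neighbour of index i.\<close>

definition spoke :: "'a ugraph \<Rightarrow> ('a \<Rightarrow> 'a \<Rightarrow> 6) \<Rightarrow> 'a \<Rightarrow> 6 \<Rightarrow> 'a set" where
  "spoke G idx v i = {THE u. u \<in> neighbours G v \<and> idx v u = i, v}"

text \<open>
  A blue perfect matching restricts to one of the two perfect matchings of the 6-cycle
  of blue edges of each hexagon (lemma \<open>blue_matching_cases\<close>), so the else branch is the case
  of the restriction consisting of the edges 12, 34, 50.
\<close>

definition encoded_rotation ::
    "'a ugraph \<Rightarrow> ('a \<Rightarrow> 'a \<Rightarrow> 6) \<Rightarrow> ('a \<times> 6) set set \<Rightarrow> 'a \<Rightarrow> 'a set \<Rightarrow> 'a set" where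
  "encoded_rotation G idx M v =
     (if M \<inter> (hex_blue v \<union> hex_red v) = {{(v, 0), (v, 1)}, {(v, 2), (v, 3)}, {(v, 4), (v, 5)}}
      then cycle_of_list [spoke G idx v 0, spoke G idx v 1, spoke G idx v 2]
      else cycle_of_list [spoke G idx v 0, spoke G idx v 2, spoke G idx v 1])"

lemma Z6_UNIV: "(UNIV :: 6 set) = {0, 1, 2, 3, 4, 5}"
  by (rule sym, rule card_subset_eq) simp_all

lemma hex_blue_eq:
  "hex_blue v = {{(v, 0), (v, 1)}, {(v, 1), (v, 2)}, {(v, 2), (v, 3)},
                 {(v, 3), (v, 4)}, {(v, 4), (v, 5)}, {(v, 5), (v, 0)}}"
proof -
  have six: "(6 :: 6) = 0" by simp
  have "hex_blue v = (\<lambda>i. {(v, i), (v, i + 1)}) ` (UNIV :: 6 set)"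
    unfolding hex_blue_def by auto
  also have "\<dots> = (\<lambda>i. {(v, i), (v, i + 1)}) ` {0, 1, 2, 3, 4, 5}"
    by (simp only: Z6_UNIV)
  also have "\<dots> = {{(v, 0), (v, 1)}, {(v, 1), (v, 2)}, {(v, 2), (v, 3)},
                 {(v, 3), (v, 4)}, {(v, 4), (v, 5)}, {(v, 5), (v, 0)}}"
    by (simp add: six)
  finally show ?thesis .
qed

lemma hex_red_eq:
  "hex_red v = {{(v, 0), (v, 3)}, {(v, 1), (v, 4)}, {(v, 2), (v, 5)}}"
proof -
  have "hex_red v = (\<lambda>i. {(v, i), (v, i + 3)}) ` (UNIV :: 6 set)"
    unfolding hex_red_def by auto
  also have "\<dots> = (\<lambda>i. {(v, i), (v, i + 3)}) ` {0, 1, 2, 3, 4, 5}"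
    by (simp only: Z6_UNIV)
  also have "\<dots> = {{(v, 0), (v, 3)}, {(v, 1), (v, 4)}, {(v, 2), (v, 5)}}"
    by (auto simp: insert_commute)
  finally show ?thesis .
qed

lemma blue_matching_cases:
  assumes "blue_perfect_matching G idx M" and "v \<in> verts G"
  shows "M \<inter> (hex_blue v \<union> hex_red v) = {{(v, 0), (v, 1)}, {(v, 2), (v, 3)}, {(v, 4), (v, 5)}} \<or>
         M \<inter> (hex_blue v \<union> hex_red v) = {{(v, 1), (v, 2)}, {(v, 3), (v, 4)}, {(v, 5), (v, 0)}}"
proof -
  have blue: "M \<subseteq> blue_edges G" and pm: "\<And>i. \<exists>!e. e \<in> M \<and> (v, i) \<in> e"
    using assms
    by (auto simp: blue_perfect_matching_def perfect_matching_def hexagon_graph_def)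
  have at_v: "e \<in> hex_blue v" if "e \<in> M" "(v, i) \<in> e" for e i
    using that blue by (auto simp: blue_edges_def hex_blue_def)
  have not_red: "e \<notin> hex_red v" if "e \<in> M" for e
  proof
    assume red: "e \<in> hex_red v"
    then obtain i where "(v, i) \<in> e" by (auto simp: hex_red_def)
    with at_v[OF that] have "e \<in> hex_blue v" .
    with red show False by (auto simp: hex_red_eq hex_blue_eq doubleton_eq_iff)
  qed
  have restr: "M \<inter> (hex_blue v \<union> hex_red v) = M \<inter> hex_blue v"
    using not_red by blast
  have some: "\<exists>e \<in> hex_blue v. e \<in> M \<and> (v, i) \<in> e" for i
    using pm[of i] at_v by blast
  have uniq: "e = f" if "e \<in> M" "f \<in> M" "(v, i) \<in> e" "(v, i) \<in> f" for e f i
    using pm[of i] that by blast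
  let ?b = "\<lambda>i j. {(v, i :: 6), (v, j)}"
  have s: "?b 0 1 \<in> M \<or> ?b 5 0 \<in> M" "?b 0 1 \<in> M \<or> ?b 1 2 \<in> M" "?b 1 2 \<in> M \<or> ?b 2 3 \<in> M"
    "?b 2 3 \<in> M \<or> ?b 3 4 \<in> M" "?b 3 4 \<in> M \<or> ?b 4 5 \<in> M" "?b 4 5 \<in> M \<or> ?b 5 0 \<in> M"
    using some[of 0] some[of 1] some[of 2] some[of 3] some[of 4] some[of 5]
    unfolding hex_blue_eq by auto
  have u: "\<not> (?b 0 1 \<in> M \<and> ?b 5 0 \<in> M)" "\<not> (?b 0 1 \<in> M \<and> ?b 1 2 \<in> M)"
    "\<not> (?b 1 2 \<in> M \<and> ?b 2 3 \<in> M)" "\<not> (?b 2 3 \<in> M \<and> ?b 3 4 \<in> M)"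
    "\<not> (?b 3 4 \<in> M \<and> ?b 4 5 \<in> M)" "\<not> (?b 4 5 \<in> M \<and> ?b 5 0 \<in> M)"
    using uniq[of "?b 0 1" "?b 5 0" 0] uniq[of "?b 0 1" "?b 1 2" 1] uniq[of "?b 1 2" "?b 2 3" 2]
      uniq[of "?b 2 3" "?b 3 4" 3] uniq[of "?b 3 4" "?b 4 5" 4] uniq[of "?b 4 5" "?b 5 0" 5]
    by (auto simp: doubleton_eq_iff)
  show ?thesis
  proof (cases "?b 0 1 \<in> M")
    case True
    then have "?b 2 3 \<in> M" "?b 4 5 \<in> M" "?b 1 2 \<notin> M" "?b 3 4 \<notin> M" "?b 5 0 \<notin> M"
      using s u by blast+
    with True show ?thesis unfolding restr unfolding hex_blue_eq by (intro disjI1) (simp only: Int_insert_right if_True if_False Int_empty_right)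
  next
    case False
    then have "?b 1 2 \<in> M" "?b 3 4 \<in> M" "?b 5 0 \<in> M" "?b 2 3 \<notin> M" "?b 4 5 \<notin> M"
      using s u by blast+
    with False show ?thesis unfolding restr unfolding hex_blue_eq by (intro disjI2) (simp only: Int_insert_right if_True if_False Int_empty_right)
  qed
qed

lemma encoded_rotation_system:
  assumes "finite_simple_graph G" and "cubic G" and "hexagon_indexing G idx"
  shows "rotation_system G (encoded_rotation G idx M)"
  unfolding rotation_system_def
proof
  fix v assume v: "v \<in> verts G"
  have simple: "e \<subseteq> verts G" "card e = 2" if "e \<in> edges G" for e
    using assms(1) that by (auto simp: finite_simple_graph_def)
  have inc: "incident G v = (\<lambda>u. {u, v}) ` neighbours G v"
  proof
    show "incident G v \<subseteq> (\<lambda>u. {u, v}) ` neighbours G v"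
    proof
      fix e assume e: "e \<in> incident G v"
      then obtain a b where "e = {a, b}"
        using simple(2)[of e] by (auto simp: incident_def card_2_iff)
      with e show "e \<in> (\<lambda>u. {u, v}) ` neighbours G v"
        by (auto simp: incident_def neighbours_def insert_commute)
    qed
  qed (auto simp: incident_def neighbours_def)
  have inj: "inj_on (\<lambda>u. {u, v}) (neighbours G v)"
    by (auto simp: inj_on_def doubleton_eq_iff)
  have "card (neighbours G v) = 3"
    using assms(2) v card_image[OF inj] by (metis cubic_def inc)
  moreover have idx: "inj_on (idx v) (neighbours G v)" "idx v ` neighbours G v \<subseteq> {0, 1, 2}"
    using assms(3) v by (auto simp: hexagon_indexing_def)
  ultimately have im: "idx v ` neighbours G v = {0, 1, 2}"
    by (intro card_subset_eq) (simp_all add: card_image)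
  define n where "n i = (THE u. u \<in> neighbours G v \<and> idx v u = i)" for i
  have n: "n (idx v u) = u" if "u \<in> neighbours G v" for u
    unfolding n_def using that idx(1) by (auto simp: inj_on_def)
  have nbrs: "neighbours G v = n ` {0, 1, 2}"
    unfolding im[symmetric] by (force simp: n)
  have n_idx: "n i \<in> neighbours G v \<and> idx v (n i) = i" if "i \<in> {0, 1, 2}" for i
    using that n unfolding im[symmetric] by auto
  have dist: "n 0 \<noteq> n 1" "n 0 \<noteq> n 2" "n 1 \<noteq> n 2"
    using n_idx[of 0] n_idx[of 1] n_idx[of 2] by auto
  have sp: "spoke G idx v i = {n i, v}" for i
    by (simp add: spoke_def n_def)
  let ?as = "[spoke G idx v 0, spoke G idx v 1, spoke G idx v 2]"
  let ?bs = "[spoke G idx v 0, spoke G idx v 2, spoke G idx v 1]"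
  have "distinct ?as" "distinct ?bs" "set ?as = incident G v" "set ?bs = incident G v"
    using dist by (auto simp: sp inc nbrs doubleton_eq_iff)
  then show "\<exists>es. distinct es \<and> set es = incident G v \<and>
      encoded_rotation G idx M v = cycle_of_list es"
    unfolding encoded_rotation_def by metis
qed

end

theory Submission
  imports Defs
begin

text \<open>
  Every dart (u, v) of G corresponds to one white edge, directed from side Y in the hexagon of u
  to side X in the hexagon of v. The blue edge of M at its endpoint in X leads to the white edge of
  the dart that follows (u, v) on its face. So the cycles of the union of M and W are the orbits
  of the face successor on darts. Each red edge joins the end in X of the white edge of
  some dart (u, v) to the end in Y of the white edge of (v, u), so a cycle contains both ends of a
  red edge iff some face traverses an edge in both directions.
\<close>

section \<open>Faces as orbits of darts\<close>

lemma funpow_swap: "(p ^^ k) ((p ^^ n) a) = (p ^^ n) ((p ^^ k) a)"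
  by (simp add: funpow_add[THEN fun_cong, unfolded comp_apply, symmetric] add.commute)

text \<open>The injective map \<open>p ^^ n\<close> commutes with all powers of \<open>p\<close>, so
  \<open>a\<close> and \<open>(p ^^ n) a\<close> are fixed by the same powers.\<close>

lemma least_power_funpow:
  assumes "permutation p"
  shows "least_power p ((p ^^ n) a) = least_power p a"
proof -
  have "inj (p ^^ n)"
    using permutation_bijective[OF permutation_funpow[OF assms]] by (rule bij_is_inj)
  then have "(p ^^ k) ((p ^^ n) a) = (p ^^ n) a \<longleftrightarrow> (p ^^ k) a = a" for k
    by (simp add: inj_eq funpow_swap[of k p n])
  then show ?thesis
    by (simp add: least_power_def)
qed

text \<open>Entry \<open>i\<close> of a support is the \<open>i\<close>-th iterate, and indices wrap
  at a period. Hence the rotations of a face walk are the walks of the same orbit begun at other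
  darts.\<close>

lemma rotate_support:
  assumes "permutation p"
  shows "rotate n (support p a) = support p ((p ^^ n) a)"
proof (rule nth_equalityI)
  fix i assume "i < length (rotate n (support p a))"
  then have i: "i < least_power p a"
    by simp
  have "(p ^^ ((n + i) mod least_power p a)) a = (p ^^ (i + n)) a"
    by (simp add: funpow_mod_eq[OF least_power_of_permutation(1)[OF assms]] add.commute)
  then show "rotate n (support p a) ! i = support p ((p ^^ n) a) ! i"
    using i by (simp add: nth_rotate least_power_funpow[OF assms] funpow_add add.commute)
qed (simp add: least_power_funpow[OF assms])

section \<open>Darts and the face successor\<close>

definition darts :: "'a ugraph \<Rightarrow> ('a \<times> 'a) set" where
  "darts G = {(x, y). {x, y} \<in> edges G}"

lemma darts_iff [simp]: "(x, y) \<in> darts G \<longleftrightarrow> {x, y} \<in> edges G"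
  by (simp add: darts_def)

text \<open>The identity outside the darts makes this a permutation of the whole type.\<close>

definition face_succ :: "'a ugraph \<Rightarrow> ('a \<Rightarrow> 'a set \<Rightarrow> 'a set) \<Rightarrow> 'a \<times> 'a \<Rightarrow> 'a \<times> 'a" where
  "face_succ G \<pi> d = (if d \<in> darts G
     then (snd d, THE z. \<pi> (snd d) {fst d, snd d} = {snd d, z}) else d)"

text \<open>With the end \<open>y\<close> fixed, an unordered pair determines its other end, so only
  \<open>z\<close> satisfies the description in \<open>face_succ\<close>.\<close>

lemma face_succ_eqI:
  assumes "{x, y} \<in> edges G" and "\<pi> y {x, y} = {y, z}"
  shows "face_succ G \<pi> (x, y) = (y, z)"
proof -
  have "(THE z. \<pi> y {x, y} = {y, z}) = z"
    using assms(2) by (intro the_equality) (auto simp: doubleton_eq_iff)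
  with assms(1) show ?thesis
    by (simp add: face_succ_def)
qed

lemma edge_verts:
  assumes "finite_simple_graph G" and "{x, y} \<in> edges G"
  shows "x \<in> verts G" and "y \<in> verts G"
  using assms unfolding finite_simple_graph_def by blast+

lemma finite_darts:
  assumes "finite_simple_graph G"
  shows "finite (darts G)"
proof -
  have "darts G \<subseteq> verts G \<times> verts G"
    using edge_verts[OF assms] by auto
  moreover have "finite (verts G \<times> verts G)"
    using assms by (simp add: finite_simple_graph_def)
  ultimately show ?thesis
    by (rule finite_subset)
qed

lemma dart_irrefl:
  assumes "finite_simple_graph G"
  shows "{x, x} \<notin> edges G"
  using assms by (auto simp: finite_simple_graph_def)

text \<open>\<open>cycle_of_list es\<close> permutes \<open>set es\<close> and fixes everything
  else, which gives injectivity on the whole type.\<close>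

lemma rotation_system_bij:
  assumes "rotation_system G \<pi>" and "v \<in> verts G"
  shows "inj (\<pi> v)" and "\<pi> v e \<in> incident G v \<longleftrightarrow> e \<in> incident G v"
proof -
  obtain es where es: "set es = incident G v" "\<pi> v = cycle_of_list es"
    using assms by (auto simp: rotation_system_def)
  then have "\<pi> v permutes incident G v"
    using cycle_permutes[of es] by simp
  then show "inj (\<pi> v)" "\<pi> v e \<in> incident G v \<longleftrightarrow> e \<in> incident G v"
    by (auto simp: permutes_inj permutes_in_image)
qed

locale graph_embedding =
  fixes G :: "'a ugraph" and \<pi> :: "'a \<Rightarrow> 'a set \<Rightarrow> 'a set"
  assumes simple: "finite_simple_graph G"
    and rotation: "rotation_system G \<pi>"
begin

abbreviation \<phi> :: "'a \<times> 'a \<Rightarrow> 'a \<times> 'a" where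
  "\<phi> \<equiv> face_succ G \<pi>"

text \<open>\<open>\<pi> y\<close> keeps the edges at \<open>y\<close> among themselves, so the
  image of \<open>{x, y}\<close> is again an edge with end \<open>y\<close>; \<open>z\<close> is its
  other end.\<close>

lemma face_succ_cases:
  assumes "{x, y} \<in> edges G"
  obtains z where "{y, z} \<in> edges G" "\<pi> y {x, y} = {y, z}" "\<phi> (x, y) = (y, z)"
proof -
  have y: "y \<in> verts G"
    using edge_verts[OF simple assms] by simp
  have "\<pi> y {x, y} \<in> incident G y"
    using assms rotation_system_bij(2)[OF rotation y] by (simp add: incident_def)
  then have e: "\<pi> y {x, y} \<in> edges G" "y \<in> \<pi> y {x, y}" "card (\<pi> y {x, y}) = 2"
    using simple by (auto simp: incident_def finite_simple_graph_def)
  obtain a b where ab: "\<pi> y {x, y} = {a, b}"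
    using e(3) unfolding card_2_iff by blast
  with e(2) have "y = a \<or> y = b"
    by simp
  then have "\<exists>z. \<pi> y {x, y} = {y, z}"
    unfolding ab by (auto simp: doubleton_eq_iff)
  then obtain z where z: "\<pi> y {x, y} = {y, z}"
    by blast
  have "{y, z} \<in> edges G"
    using e(1) by (simp only: z)
  then show thesis
    using z face_succ_eqI[of x y G \<pi> z] assms by (intro that)
qed

lemma face_succ_dart: "d \<in> darts G \<Longrightarrow> \<phi> d \<in> darts G"
  by (metis darts_iff face_succ_cases surj_pair)

text \<open>Equal successors share the vertex \<open>y\<close> and the value of
  \<open>\<pi> y\<close>; injectivity of \<open>\<pi> y\<close> returns the edge, and
  \<open>y\<close> its direction. An injective self-map of the finite set of darts is a
  bijection.\<close>

lemma permutation_face_succ: "permutation \<phi>"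
proof -
  have "inj_on \<phi> (darts G)"
  proof (rule inj_onI, goal_cases)
    case (1 d d')
    obtain x y x' y' where d: "d = (x, y)" "d' = (x', y')"
      by (cases d, cases d')
    from 1 have eq: "\<phi> (x, y) = \<phi> (x', y')" and e: "{x, y} \<in> edges G" "{x', y'} \<in> edges G"
      by (simp_all add: d)
    obtain z where z: "\<pi> y {x, y} = {y, z}" "\<phi> (x, y) = (y, z)"
      using face_succ_cases[OF e(1)] by metis
    obtain z' where z': "\<pi> y' {x', y'} = {y', z'}" "\<phi> (x', y') = (y', z')"
      using face_succ_cases[OF e(2)] by metis
    have y: "y' = y" and "\<pi> y {x, y} = \<pi> y {x', y}"
      using eq z z' by auto
    moreover have "y \<in> verts G"
      using edge_verts[OF simple e(1)] by simp
    ultimately have "{x, y} = {x', y}"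
      using rotation_system_bij(1)[OF rotation] by (simp add: inj_eq)
    with y d show "d = d'"
      by (auto simp: doubleton_eq_iff)
  qed
  moreover have "\<phi> ` darts G \<subseteq> darts G"
    using face_succ_dart by blast
  ultimately have "bij_betw \<phi> (darts G) (darts G)"
    using finite_darts[OF simple] by (simp add: bij_betw_def endo_inj_surj)
  then have "\<phi> permutes darts G"
    by (rule bij_imp_permutes) (simp add: face_succ_def)
  then show ?thesis
    using finite_darts[OF simple] by (rule permutes_imp_permutation[rotated])
qed

lemma funpow_face_succ_dart: "d \<in> darts G \<Longrightarrow> (\<phi> ^^ n) d \<in> darts G"
  by (induction n) (simp_all add: face_succ_dart)

section \<open>Face walks as orbits\<close>

lemma face_step_iff:
  "(let (x, y) = d; (x', y') = d' in {x, y} \<in> edges G \<and> x' = y \<and> \<pi> y {x, y} = {x', y'}) \<longleftrightarrow>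
    d \<in> darts G \<and> d' = \<phi> d"
proof (cases d)
  case (Pair x y)
  show ?thesis
  proof (cases "{x, y} \<in> edges G")
    case True
    obtain z where "\<pi> y {x, y} = {y, z}" "\<phi> (x, y) = (y, z)"
      using face_succ_cases[OF True] by metis
    with True show ?thesis
      by (cases d') (auto simp: Pair doubleton_eq_iff)
  qed (simp add: Pair split_beta)
qed

text \<open>A face walk iterates \<open>\<phi>\<close> and stops at the first return, so its length
  is \<open>least_power \<phi> d\<close>, which is where \<open>support\<close> stops too.\<close>

lemma face_walk_iff: "face_walk G \<pi> ds \<longleftrightarrow> (\<exists>d\<in>darts G. ds = support \<phi> d)"
proof
  assume walk: "face_walk G \<pi> ds"
  let ?n = "length ds"
  define d where "d = ds ! 0"
  have n: "0 < ?n"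
    using walk by (simp add: face_walk_def)
  have step: "ds ! i \<in> darts G" "ds ! (Suc i mod ?n) = \<phi> (ds ! i)" if "i < ?n" for i
    using walk that unfolding face_walk_def face_step_iff by auto
  have no_return: "ds ! i \<noteq> d" if "0 < i" "i < ?n" for i
    using walk that by (simp add: face_walk_def d_def)
  have nth: "ds ! i = (\<phi> ^^ i) d" if "i < ?n" for i
    using that
  proof (induction i)
    case (Suc i)
    with step(2)[of i] show ?case
      by simp
  qed (simp add: d_def)
  \<comment> \<open>Index \<open>m\<close> is the last one; its successor modulo the length is 0, so
    one more application of \<open>\<phi>\<close> closes the walk.\<close>
  obtain m where m: "?n = Suc m"
    using n by (cases "?n") auto
  have "(\<phi> ^^ ?n) d = d"
    using step(2)[of m] nth[of m] by (simp add: m d_def)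
  moreover have "?n \<le> k" if "(\<phi> ^^ k) d = d \<and> 0 < k" for k
    using that no_return[of k] nth[of k] by (metis not_le)
  ultimately have "least_power \<phi> d = ?n"
    unfolding least_power_def using n by (intro Least_equality) simp_all
  then have "ds = support \<phi> d"
    by (intro nth_equalityI) (simp_all add: nth)
  with step(1)[OF n] show "\<exists>d\<in>darts G. ds = support \<phi> d"
    unfolding d_def by blast
next
  assume "\<exists>d\<in>darts G. ds = support \<phi> d"
  then obtain d where d: "d \<in> darts G" and ds: "ds = support \<phi> d"
    by blast
  let ?n = "least_power \<phi> d"
  note period = least_power_of_permutation[OF permutation_face_succ, of d]
  have len: "length ds = ?n" and dist: "distinct ds"
    using cycle_of_permutation[OF permutation_face_succ, of d] by (simp_all add: ds)
  \<comment> \<open>Reducing the index modulo the period treats the inner steps and the closing step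
    alike.\<close>
  have nth: "ds ! (i mod ?n) = (\<phi> ^^ i) d" for i
    using period by (simp add: ds funpow_mod_eq)
  have "ds ! i \<in> darts G \<and> ds ! (Suc i mod ?n) = \<phi> (ds ! i)" if "i < ?n" for i
    using nth[of i] nth[of "Suc i"] that funpow_face_succ_dart[OF d, of i] by simp
  moreover have "ds ! i \<noteq> ds ! 0" if "i < ?n" "0 < i" for i
    using that dist by (simp add: nth_eq_iff_index_eq len)
  moreover have "ds \<noteq> []"
    using period(2) len by auto
  ultimately show "face_walk G \<pi> ds"
    unfolding face_walk_def face_step_iff len by blast
qed

section \<open>Faces and dual loops\<close>

definition face :: "'a \<times> 'a \<Rightarrow> ('a \<times> 'a) list set" where
  "face d = range (\<lambda>n. rotate n (support \<phi> d))"

lemma faces_eq: "faces G \<pi> = face ` darts G"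
  unfolding faces_def face_walk_iff face_def full_SetCompr_eq by blast

lemma support_in_face: "support \<phi> d \<in> face d"
  unfolding face_def by (metis id_apply rangeI rotate0)

lemma set_in_face: "ds \<in> face d \<Longrightarrow> set ds = set (support \<phi> d)"
  by (auto simp only: face_def set_rotate)

lemma on_face_boundary_iff:
  "on_face_boundary {x, y} (face d) \<longleftrightarrow>
    (x, y) \<in> set (support \<phi> d) \<or> (y, x) \<in> set (support \<phi> d)"
proof -
  have "on_face_boundary {x, y} (face d) \<longleftrightarrow>
      (\<exists>(a, b)\<in>set (support \<phi> d). {x, y} = {a, b})"
    unfolding on_face_boundary_def using support_in_face[of d] set_in_face[of _ d] by metis
  then show ?thesis
    by (auto simp only: doubleton_eq_iff split: prod.splits)
qed

text \<open>Starting at a later dart of the orbit only rotates the walk, which gives one inclusion;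
  the remaining steps of the period lead back to \<open>d\<close> and give the other.\<close>

lemma same_face:
  assumes "d' \<in> set (support \<phi> d)"
  shows "face d' = face d"
proof -
  have face_funpow: "face ((\<phi> ^^ k) a) \<subseteq> face a" for k a
    unfolding face_def rotate_support[OF permutation_face_succ, of k a, symmetric] rotate_rotate
    by blast
  obtain k where k: "k < least_power \<phi> d" "d' = (\<phi> ^^ k) d"
    using assms by auto
  then have "(\<phi> ^^ (least_power \<phi> d - k)) d' = (\<phi> ^^ least_power \<phi> d) d"
    by (simp add: funpow_add[THEN fun_cong, unfolded comp_apply, symmetric])
  then have "(\<phi> ^^ (least_power \<phi> d - k)) d' = d"
    using least_power_of_permutation(1)[OF permutation_face_succ] by simp
  then show ?thesis
    using face_funpow[of k d] face_funpow[of "least_power \<phi> d - k" d'] k(2) by auto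
qed

lemma dart_in_support: "d \<in> set (support \<phi> d)"
  unfolding support_set[OF permutation_face_succ] by (metis funpow_0 rangeI)

lemma same_orbit:
  "d' \<in> set (support \<phi> d) \<Longrightarrow> set (support \<phi> d') = set (support \<phi> d)"
  using same_face set_in_face support_in_face by metis

text \<open>The faces through an edge are those of its two darts, so there is exactly one iff the
  two darts share an orbit.\<close>

lemma dual_loop_iff:
  "has_dual_loop G \<pi> \<longleftrightarrow> (\<exists>x y. {x, y} \<in> edges G \<and> (y, x) \<in> set (support \<phi> (x, y)))"
proof
  assume "has_dual_loop G \<pi>"
  then obtain e where e: "e \<in> edges G" and unique: "\<exists>!f\<in>faces G \<pi>. on_face_boundary e f"
    by (auto simp: has_dual_loop_def)
  have "card e = 2"
    using e simple by (auto simp: finite_simple_graph_def)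
  then obtain x y where xy: "e = {x, y}"
    by (auto simp: card_2_iff)
  have "face (x, y) \<in> faces G \<pi>" "face (y, x) \<in> faces G \<pi>"
    using e unfolding faces_eq xy by (simp_all add: insert_commute)
  moreover have "on_face_boundary e (face (x, y))" "on_face_boundary e (face (y, x))"
    unfolding xy on_face_boundary_iff using dart_in_support by blast+
  ultimately have "face (x, y) = face (y, x)"
    using unique by blast
  then have "support \<phi> (y, x) \<in> face (x, y)"
    using support_in_face by simp
  then have "(y, x) \<in> set (support \<phi> (x, y))"
    using dart_in_support[of "(y, x)"] set_in_face by metis
  with e xy show "\<exists>x y. {x, y} \<in> edges G \<and> (y, x) \<in> set (support \<phi> (x, y))"
    by blast
next
  assume "\<exists>x y. {x, y} \<in> edges G \<and> (y, x) \<in> set (support \<phi> (x, y))"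
  then obtain x y where e: "{x, y} \<in> edges G" and loop: "(y, x) \<in> set (support \<phi> (x, y))"
    by blast
  have "\<exists>!f\<in>faces G \<pi>. on_face_boundary {x, y} f"
  proof (rule ex1I[of _ "face (x, y)"])
    show "face (x, y) \<in> faces G \<pi> \<and> on_face_boundary {x, y} (face (x, y))"
      using e dart_in_support[of "(x, y)"] unfolding faces_eq on_face_boundary_iff by simp
  next
    fix f assume f: "f \<in> faces G \<pi> \<and> on_face_boundary {x, y} f"
    then obtain d where "f = face d"
      unfolding faces_eq by blast
    with f have "face (x, y) = f \<or> face (y, x) = f"
      using on_face_boundary_iff[of x y d] same_face by metis
    then show "f = face (x, y)"
      using same_face[OF loop] by simp
  qed
  with e show "has_dual_loop G \<pi>"
    unfolding has_dual_loop_def by blast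
qed

end

section \<open>Hexagon vertices and darts\<close>

definition neighbour :: "'a ugraph \<Rightarrow> ('a \<Rightarrow> 'a \<Rightarrow> 6) \<Rightarrow> 'a \<Rightarrow> 6 \<Rightarrow> 'a" where
  "neighbour G idx v i = (THE u. u \<in> neighbours G v \<and> idx v u = i)"

text \<open>
  The indices i and i + 3 belong to the same neighbour and have opposite parity. The tail vertex
  of (u, v) is the odd one of the two at u, the head vertex is the even one of the two at v.
\<close>

definition tail_vertex :: "('a \<Rightarrow> 'a \<Rightarrow> 6) \<Rightarrow> 'a \<times> 'a \<Rightarrow> 'a \<times> 6" where
  "tail_vertex idx = (\<lambda>(u, v). (u, if idx u v = 1 then 1 else idx u v + 3))"

definition head_vertex :: "('a \<Rightarrow> 'a \<Rightarrow> 6) \<Rightarrow> 'a \<times> 'a \<Rightarrow> 'a \<times> 6" where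
  "head_vertex idx = (\<lambda>(u, v). (v, if idx v u = 1 then 4 else idx v u))"

text \<open>Recovers a dart from either of its two vertices: adding 3 modulo 6 brings the indices 3,
  4, 5 into \<open>{0, 1, 2}\<close>, and an even index marks the head of a dart entering
  \<open>v\<close>.\<close>

definition vertex_dart :: "'a ugraph \<Rightarrow> ('a \<Rightarrow> 'a \<Rightarrow> 6) \<Rightarrow> 'a \<times> 6 \<Rightarrow> 'a \<times> 'a" where
  "vertex_dart G idx = (\<lambda>(v, i).
     let u = neighbour G idx v (if i \<in> {0, 1, 2} then i else i + 3)
     in if i \<in> {0, 2, 4} then (u, v) else (v, u))"

lemma spoke_eq: "spoke G idx v i = {neighbour G idx v i, v}"
  by (simp add: spoke_def neighbour_def)

lemma fst_tail_vertex [simp]: "fst (tail_vertex idx d) = fst d"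
  by (simp add: tail_vertex_def split_beta)

lemma fst_head_vertex [simp]: "fst (head_vertex idx d) = snd d"
  by (simp add: head_vertex_def split_beta)

lemma cycle_of_list_3:
  assumes "a \<noteq> b" and "a \<noteq> c" and "b \<noteq> c"
  shows "cycle_of_list [a, b, c] a = b" "cycle_of_list [a, b, c] b = c" "cycle_of_list [a, b, c] c = a"
  using assms by (simp_all add: transpose_def)

lemma mem_side:
  "(v, i) \<in> side_X G \<longleftrightarrow> v \<in> verts G \<and> i \<in> {0, 2, 4}"
  "(v, i) \<in> side_Y G \<longleftrightarrow> v \<in> verts G \<and> i \<in> {1, 3, 5}"
  by (auto simp: side_X_def side_Y_def)

text \<open>Shifting the indices 3, 4, 5 by 3 in \<open>vertex_dart\<close> produces these
  numerals.\<close>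

lemma Z6_numerals: "(6 :: 6) = 0" "(7 :: 6) = 1" "(8 :: 6) = 2"
  by simp_all

locale hexagon_matching =
  fixes G :: "'a ugraph" and idx :: "'a \<Rightarrow> 'a \<Rightarrow> 6" and M :: "('a \<times> 6) set set"
  assumes simple: "finite_simple_graph G" and cubic: "cubic G"
    and indexing: "hexagon_indexing G idx"
    and matching: "blue_perfect_matching G idx M"
begin

sublocale graph_embedding G "encoded_rotation G idx M"
  using simple encoded_rotation_system[OF simple cubic indexing] by unfold_locales

abbreviation nb :: "'a \<Rightarrow> 6 \<Rightarrow> 'a" where
  "nb \<equiv> neighbour G idx"

abbreviation tail :: "'a \<times> 'a \<Rightarrow> 'a \<times> 6" where
  "tail \<equiv> tail_vertex idx"

abbreviation head :: "'a \<times> 'a \<Rightarrow> 'a \<times> 6" where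
  "head \<equiv> head_vertex idx"

abbreviation dart :: "'a \<times> 6 \<Rightarrow> 'a \<times> 'a" where
  "dart \<equiv> vertex_dart G idx"

section \<open>Neighbours and their indices\<close>

lemma idx_image:
  assumes v: "v \<in> verts G"
  shows "idx v ` neighbours G v = {0, 1, 2}"
proof -
  have "incident G v = (\<lambda>u. {u, v}) ` neighbours G v"
  proof
    show "incident G v \<subseteq> (\<lambda>u. {u, v}) ` neighbours G v"
    proof
      fix e assume e: "e \<in> incident G v"
      then have "card e = 2"
        using simple by (auto simp: incident_def finite_simple_graph_def)
      then obtain a b where "e = {a, b}"
        by (auto simp: card_2_iff)
      with e show "e \<in> (\<lambda>u. {u, v}) ` neighbours G v"
        by (auto simp: incident_def neighbours_def insert_commute)
    qed
  qed (auto simp: incident_def neighbours_def)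
  moreover have "card ((\<lambda>u. {u, v}) ` neighbours G v) = card (neighbours G v)"
    by (intro card_image) (auto simp: inj_on_def doubleton_eq_iff)
  ultimately have "card (neighbours G v) = 3"
    using cubic v by (metis cubic_def)
  \<comment> \<open>The distinct indices of three neighbours exhaust
    \<open>{0, 1, 2}\<close>.\<close>
  then show ?thesis
    using indexing v by (intro card_subset_eq) (simp_all add: hexagon_indexing_def card_image)
qed

lemma idx_cases:
  assumes "{u, v} \<in> edges G"
  shows "idx v u = 0 \<or> idx v u = 1 \<or> idx v u = 2" and "idx u v = 0 \<or> idx u v = 1 \<or> idx u v = 2"
  using idx_image[OF edge_verts(1)[OF simple assms]] idx_image[OF edge_verts(2)[OF simple assms]] assms
  by (auto simp: neighbours_def insert_commute)

lemma neighbour_idx: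
  assumes "{u, v} \<in> edges G"
  shows "nb v (idx v u) = u"
proof -
  have "inj_on (idx v) (neighbours G v)"
    using indexing edge_verts(2)[OF simple assms] by (simp add: hexagon_indexing_def)
  with assms show ?thesis
    unfolding neighbour_def by (intro the_equality) (auto simp: inj_on_def neighbours_def)
qed

lemma neighbour_props:
  assumes "v \<in> verts G" and "i \<in> {0, 1, 2}"
  shows "{nb v i, v} \<in> edges G" and "idx v (nb v i) = i"
proof -
  have "i \<in> idx v ` neighbours G v"
    using assms by (simp add: idx_image)
  then show "{nb v i, v} \<in> edges G" "idx v (nb v i) = i"
    by (auto simp: neighbours_def neighbour_idx)
qed

text \<open>Makes \<open>tail\<close> and \<open>head\<close> injective on darts and lets each
  hexagon vertex name a dart; it is a check of the three possible indices at each end.\<close>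

lemma dart_tail_head:
  assumes "d \<in> darts G"
  shows "dart (tail d) = d" and "dart (head d) = d"
proof -
  obtain u v where d: "d = (u, v)" and e: "{u, v} \<in> edges G"
    using assms by (cases d) simp
  then have e': "{v, u} \<in> edges G"
    by (simp add: insert_commute)
  show "dart (tail d) = d" "dart (head d) = d"
    using idx_cases[OF e] neighbour_idx[OF e] neighbour_idx[OF e']
    by (auto simp: d vertex_dart_def tail_vertex_def head_vertex_def Z6_numerals)
qed

text \<open>Tails have odd indices, heads even ones.\<close>

lemma tail_neq_head:
  assumes "d \<in> darts G" and "d' \<in> darts G"
  shows "tail d \<noteq> head d'"
proof -
  obtain u v x y where d: "d = (u, v)" "d' = (x, y)"
    by (cases d, cases d')
  with assms have e: "{u, v} \<in> edges G" "{x, y} \<in> edges G"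
    by simp_all
  show ?thesis
    using idx_cases[OF e(1)] idx_cases[OF e(2)]
    by (auto simp: d tail_vertex_def head_vertex_def)
qed

section \<open>White and red edges in terms of darts\<close>

lemma white_pair_eq:
  assumes "{u, v} \<in> edges G"
  shows "white_pair G idx u v = {{tail (u, v), head (u, v)}, {tail (v, u), head (v, u)}}"
  \<comment> \<open>Adding 3 changes parity, and \<open>white_pair\<close> shifts exactly one end of
    each edge when the parities agree, both or neither otherwise. So each edge joins an odd index to
    an even one, the tail and the head of one dart.\<close>
  using idx_cases[OF assms] edge_verts[OF simple assms]
  by (elim disjE) (simp_all add: white_pair_def mem_side tail_vertex_def head_vertex_def insert_commute)

lemma white_edges_eq: "white_edges G idx = (\<lambda>d. {tail d, head d}) ` darts G"
proof
  show "white_edges G idx \<subseteq> (\<lambda>d. {tail d, head d}) ` darts G"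
  proof
    fix e assume "e \<in> white_edges G idx"
    then obtain u v where uv: "{u, v} \<in> edges G" "e \<in> white_pair G idx u v"
      unfolding white_edges_def by blast
    then have "e = {tail (u, v), head (u, v)} \<or> e = {tail (v, u), head (v, u)}"
      by (simp add: white_pair_eq)
    moreover have "(u, v) \<in> darts G" "(v, u) \<in> darts G"
      using uv(1) by (simp_all add: insert_commute)
    ultimately show "e \<in> (\<lambda>d. {tail d, head d}) ` darts G"
      by blast
  qed
  show "(\<lambda>d. {tail d, head d}) ` darts G \<subseteq> white_edges G idx"
  proof (rule image_subsetI)
    fix d assume "d \<in> darts G"
    then obtain u v where d: "d = (u, v)" and e: "{u, v} \<in> edges G"
      by (cases d) simp
    have "{tail d, head d} \<in> white_pair G idx u v"
      by (simp add: white_pair_eq[OF e] d)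
    with e show "{tail d, head d} \<in> white_edges G idx"
      unfolding white_edges_def by blast
  qed
qed

lemma dart_cases:
  assumes "d \<in> darts G"
  obtains v i where "v \<in> verts G" "i \<in> {0, 1, 2}" "d = (nb v i, v)"
proof -
  obtain u v where d: "d = (u, v)" and e: "{u, v} \<in> edges G"
    using assms by (cases d) simp
  show thesis
    using that[of v "idx v u"] edge_verts(2)[OF simple e] idx_cases(1)[OF e] neighbour_idx[OF e]
    by (simp add: d)
qed

lemma hex_red_darts:
  assumes "v \<in> verts G"
  shows "hex_red v = (\<lambda>i. {head (nb v i, v), tail (v, nb v i)}) ` {0, 1, 2}"
  by (simp add: hex_red_eq head_vertex_def tail_vertex_def neighbour_props(2)[OF assms]
      insert_commute)

lemma red_edges_eq: "red_edges G = (\<lambda>(u, v). {head (u, v), tail (v, u)}) ` darts G"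
proof
  show "red_edges G \<subseteq> (\<lambda>(u, v). {head (u, v), tail (v, u)}) ` darts G"
    unfolding red_edges_def using neighbour_props(1) by (force simp: hex_red_darts)
  show "(\<lambda>(u, v). {head (u, v), tail (v, u)}) ` darts G \<subseteq> red_edges G"
    unfolding red_edges_def by (auto simp del: darts_iff simp: hex_red_darts elim!: dart_cases)
qed

section \<open>The matching and the face successor\<close>

lemma face_succ_neighbour:
  assumes "v \<in> verts G" and "i \<in> {0, 1, 2}"
    and "encoded_rotation G idx M v (spoke G idx v i) = spoke G idx v j"
  shows "\<phi> (nb v i, v) = (v, nb v j)"
  using assms neighbour_props(1)[OF assms(1,2)]
  by (intro face_succ_eqI) (simp_all add: spoke_eq insert_commute)

text \<open>Darts coming from neighbours 0, 1, 2 end at indices 0, 4, 2, and darts going to them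
  start at 3, 1, 5. The edges 01, 45, 23 thus lead from each neighbour to the next in the cyclic
  order 0, 1, 2, and the edges 05, 21, 43 realise the reverse order; these are the two encoded
  rotations.\<close>

lemma matching_at:
  assumes v: "v \<in> verts G"
  shows "M \<inter> (hex_blue v \<union> hex_red v) =
    (\<lambda>i. {head (nb v i, v), tail (\<phi> (nb v i, v))}) ` {0, 1, 2}"
proof -
  let ?s = "spoke G idx v"
  let ?A = "{{(v, 0 :: 6), (v, 1)}, {(v, 2), (v, 3)}, {(v, 4), (v, 5)}}"
  let ?B = "{{(v, 1 :: 6), (v, 2)}, {(v, 3), (v, 4)}, {(v, 5), (v, 0)}}"
  have ne: "nb v i \<noteq> nb v j" if "i \<in> {0, 1, 2}" "j \<in> {0, 1, 2}" "i \<noteq> j" for i j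
    using that neighbour_props(2)[OF v] by metis
  have s: "?s 0 \<noteq> ?s 1" "?s 0 \<noteq> ?s 2" "?s 1 \<noteq> ?s 2"
    using ne[of 0 1] ne[of 0 2] ne[of 1 2] by (auto simp: spoke_eq doubleton_eq_iff)
  note vertex = head_vertex_def tail_vertex_def neighbour_props(2)[OF v]
  from blue_matching_cases[OF matching v] show ?thesis
  proof
    assume M: "M \<inter> (hex_blue v \<union> hex_red v) = ?A"
    then have "encoded_rotation G idx M v = cycle_of_list [?s 0, ?s 1, ?s 2]"
      unfolding encoded_rotation_def by (rule if_P)
    with s have "\<phi> (nb v 0, v) = (v, nb v 1)" "\<phi> (nb v 1, v) = (v, nb v 2)"
      "\<phi> (nb v 2, v) = (v, nb v 0)"
      by (intro face_succ_neighbour[OF v]; simp only: insert_iff simp_thms cycle_of_list_3)+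
    then show ?thesis
      by (simp add: M vertex insert_commute)
  next
    assume M: "M \<inter> (hex_blue v \<union> hex_red v) = ?B"
    \<comment> \<open>The edge 12 tells the two matchings apart, which selects the else branch of
      \<open>encoded_rotation\<close>.\<close>
    have "{(v, 1), (v, 2)} \<notin> ?A"
      by (simp add: doubleton_eq_iff)
    then have "M \<inter> (hex_blue v \<union> hex_red v) \<noteq> ?A"
      unfolding M by (metis insertI1)
    then have "encoded_rotation G idx M v = cycle_of_list [?s 0, ?s 2, ?s 1]"
      unfolding encoded_rotation_def by (rule if_not_P)
    with s have "\<phi> (nb v 0, v) = (v, nb v 2)" "\<phi> (nb v 2, v) = (v, nb v 1)"
      "\<phi> (nb v 1, v) = (v, nb v 0)"
      by (intro face_succ_neighbour[OF v]; simp only: insert_iff simp_thms cycle_of_list_3)+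
    then show ?thesis
      by (simp add: M vertex insert_commute)
  qed
qed

lemma matching_iff: "e \<in> M \<longleftrightarrow> (\<exists>d\<in>darts G. e = {head d, tail (\<phi> d)})"
proof
  assume e: "e \<in> M"
  then obtain v where v: "v \<in> verts G" "e \<in> hex_blue v"
    using matching by (auto simp: blue_perfect_matching_def blue_edges_def)
  with e obtain i where "i \<in> {0, 1, 2}" "e = {head (nb v i, v), tail (\<phi> (nb v i, v))}"
    using matching_at[OF v(1)] by blast
  moreover from this have "(nb v i, v) \<in> darts G"
    using neighbour_props(1)[OF v(1)] by simp
  ultimately show "\<exists>d\<in>darts G. e = {head d, tail (\<phi> d)}"
    by blast
next
  assume "\<exists>d\<in>darts G. e = {head d, tail (\<phi> d)}"
  then obtain d where d: "d \<in> darts G" "e = {head d, tail (\<phi> d)}"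
    by blast
  obtain v i where "v \<in> verts G" "i \<in> {0, 1, 2}" "d = (nb v i, v)"
    using dart_cases[OF d(1)] by metis
  then show "e \<in> M"
    unfolding d(2) using matching_at[of v] by blast
qed

section \<open>Alternating cycles and face orbits\<close>

lemma fst_face_succ: "d \<in> darts G \<Longrightarrow> fst (\<phi> d) = snd d"
  by (simp add: face_succ_def)

text \<open>A matching edge stays inside one hexagon, while a white edge joins two different ones.
  So the symmetric difference is the union.\<close>

lemma matching_white_disjoint: "M \<inter> white_edges G idx = {}"
proof -
  have False if "d \<in> darts G" "d' \<in> darts G" and eq: "{head d, tail (\<phi> d)} = {tail d', head d'}" for d d'
  proof -
    from eq have "fst ` {head d, tail (\<phi> d)} = fst ` {tail d', head d'}"
      by (rule arg_cong)
    then have "{snd d} = {fst d', snd d'}"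
      using that(1) by (simp add: fst_face_succ)
    then show False
      using that(2) dart_irrefl[OF simple] by (cases d') auto
  qed
  then show ?thesis
    unfolding disjoint_iff matching_iff white_edges_eq by blast
qed

text \<open>The two ends of a white edge name the same dart, those of a matching edge name
  \<open>d\<close> and \<open>\<phi> d\<close>.\<close>

lemma same_orbit_edge:
  assumes "{p, q} \<in> M \<union> white_edges G idx"
  shows "set (support \<phi> (dart p)) = set (support \<phi> (dart q))"
proof -
  from assms consider d where "d \<in> darts G" "{p, q} = {head d, tail (\<phi> d)}"
    | d where "d \<in> darts G" "{p, q} = {tail d, head d}"
    unfolding Un_iff matching_iff white_edges_eq by blast
  then show ?thesis
  proof cases
    case (1 d)
    have "\<phi> d \<in> set (support \<phi> d)"
      unfolding support_set[OF permutation_face_succ]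
      using rangeI[of "\<lambda>i. (\<phi> ^^ i) d" 1] by simp
    then have "set (support \<phi> (\<phi> d)) = set (support \<phi> d)"
      by (rule same_orbit)
    then show ?thesis
      using 1 face_succ_dart[OF 1(1)] unfolding doubleton_eq_iff
      by (elim disjE conjE) (simp_all only: dart_tail_head)
  next
    case (2 d)
    then show ?thesis
      unfolding doubleton_eq_iff by (elim disjE conjE) (simp_all only: dart_tail_head)
  qed
qed

text \<open>The orbit is constant along the cycle, while the ends of the red edge name opposite
  darts of one edge of \<open>G\<close>; hence these darts share a face.\<close>

lemma dual_loop_of_cycle:
  assumes cyc: "cycle_in (sym_diff M (white_edges G idx)) xs"
    and r: "r \<in> red_edges G" "r \<subseteq> set xs"
  shows "has_dual_loop G (encoded_rotation G idx M)"
proof -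
  let ?orb = "\<lambda>p. set (support \<phi> (dart p))"
  have orb: "?orb (xs ! i) = ?orb (xs ! 0)" if "i < length xs" for i
    using that
  proof (induction i)
    case (Suc i)
    then have "{xs ! i, xs ! Suc i} \<in> M \<union> white_edges G idx"
      using cyc unfolding cycle_in_def by (metis DiffD1 Suc_lessD UnE UnI1 UnI2 mod_less)
    then show ?case
      using same_orbit_edge Suc by simp
  qed simp
  obtain u v where e: "{u, v} \<in> edges G" and uv: "r = {head (u, v), tail (v, u)}"
    using r(1) by (auto simp: red_edges_eq)
  then have d: "(u, v) \<in> darts G" "(v, u) \<in> darts G"
    by (simp_all add: insert_commute)
  have "?orb (head (u, v)) = ?orb (tail (v, u))"
    using r(2) orb unfolding uv by (metis in_set_conv_nth insert_subset)
  then have "(v, u) \<in> set (support \<phi> (u, v))"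
    using dart_in_support[of "(v, u)"] by (simp only: dart_tail_head d)
  with e show ?thesis
    unfolding dual_loop_iff by blast
qed

lemma cycle_of_dual_loop:
  assumes "has_dual_loop G (encoded_rotation G idx M)"
  shows "\<exists>xs. cycle_in (sym_diff M (white_edges G idx)) xs \<and> (\<exists>r\<in>red_edges G. r \<subseteq> set xs)"
proof -
  obtain x y where e: "{x, y} \<in> edges G" and loop: "(y, x) \<in> set (support \<phi> (x, y))"
    using assms unfolding dual_loop_iff by blast
  define n where "n = least_power \<phi> (x, y)"
  define d where "d k = (\<phi> ^^ k) (x, y)" for k
  \<comment> \<open>Position \<open>2 * k\<close> holds the tail of \<open>d k\<close> and position
    \<open>2 * k + 1\<close> its head, so the list follows the face over one period.\<close>
  define f where "f j = (if even j then tail else head) (d (j div 2))" for j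
  define xs where "xs = map f [0..<2 * n]"
  have d: "d k \<in> darts G" for k
    unfolding d_def using e by (intro funpow_face_succ_dart) simp
  have d_Suc: "d (Suc k) = \<phi> (d k)" for k
    by (simp add: d_def)
  have d_n: "d n = d 0"
    using least_power_of_permutation(1)[OF permutation_face_succ] by (simp add: d_def n_def)
  have supp: "set (support \<phi> (x, y)) = d ` {..<n}"
    by (simp add: n_def d_def[abs_def] atLeast0LessThan)
  have "distinct (map d [0..<n])"
    using cycle_of_permutation[OF permutation_face_succ, of "(x, y)"]
    by (simp only: n_def d_def[abs_def])
  then have d_inj: "inj_on d {..<n}"
    by (simp add: distinct_map atLeast0LessThan)
  have "x \<noteq> y"
    using e dart_irrefl[OF simple] by auto
  \<comment> \<open>Period 1 would force \<open>(y, x) = (x, y)\<close>. With \<open>n\<close> at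
    least 2 the list has at least 4 entries, enough for a cycle.\<close>
  have "n \<noteq> 0"
    using loop unfolding supp by auto
  moreover have "n \<noteq> 1"
    using loop \<open>x \<noteq> y\<close> unfolding supp by (auto simp: d_def)
  ultimately have n: "2 \<le> n"
    by simp
  have "inj_on f {..<2 * n}"
  proof (rule inj_onI)
    fix j k assume jk: "j \<in> {..<2 * n}" "k \<in> {..<2 * n}" and eq: "f j = f k"
    \<comment> \<open>Parity separates tails from heads; \<open>dart\<close> then recovers
      \<open>d (j div 2)\<close>, and \<open>d\<close> is injective over one period.\<close>
    have parity: "even j \<longleftrightarrow> even k"
      using eq tail_neq_head[OF d d] by (auto simp: f_def dest: sym split: if_splits)
    have "dart (f j) = d (j div 2)" for j
      by (simp add: f_def dart_tail_head[OF d])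
    then have "d (j div 2) = d (k div 2)"
      using eq by metis
    then have "j div 2 = k div 2"
      using jk by (intro inj_onD[OF d_inj]) auto
    with parity show "j = k"
      by (metis even_two_times_div_two odd_two_times_div_two_succ)
  qed
  then have "distinct xs"
    by (simp add: xs_def distinct_map atLeast0LessThan)
  moreover have "{xs ! i, xs ! (Suc i mod length xs)} \<in> sym_diff M (white_edges G idx)"
    if i: "i < length xs" for i
  proof -
    \<comment> \<open>The position after the last is \<open>2 * n\<close>, where \<open>f\<close>
      gives the tail of \<open>d n = d 0\<close>, so \<open>f (Suc i)\<close> also describes the
      closing edge.\<close>
    have "xs ! (Suc i mod length xs) = f (Suc i)"
    proof (cases "Suc i = 2 * n")
      case True
      then have "f (Suc i) = f 0"
        using d_n by (simp add: f_def)
      with True n show ?thesis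
        by (simp add: xs_def)
    qed (use i in \<open>simp add: xs_def\<close>)
    moreover have "{f i, f (Suc i)} \<in> M \<union> white_edges G idx"
    \<comment> \<open>From a tail the white edge leads to the head of the same dart; from a head the
      matching edge leads to the tail of the next dart.\<close>
    proof (cases "even i")
      case True
      then show ?thesis
        using d by (auto simp: f_def white_edges_eq)
    next
      case False
      then have "Suc i div 2 = Suc (i div 2)"
        by simp
      with False show ?thesis
        using d by (auto simp: f_def matching_iff d_Suc)
    qed
    ultimately show ?thesis
      using i matching_white_disjoint by (auto simp: xs_def)
  qed
  ultimately have "cycle_in (sym_diff M (white_edges G idx)) xs"
    using n by (simp add: cycle_in_def xs_def)
  moreover have "head (x, y) \<in> set xs"
  proof -
    have "head (x, y) = f 1" "1 < 2 * n"
      using n by (simp_all add: f_def d_def)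
    then show ?thesis
      by (simp add: xs_def)
  qed
  moreover have "tail (y, x) \<in> set xs"
  proof -
    obtain k where "k < n" "(y, x) = d k"
      using loop unfolding supp by auto
    then have "tail (y, x) = f (2 * k)" "2 * k < 2 * n"
      by (simp_all add: f_def)
    then show ?thesis
      by (simp add: xs_def)
  qed
  \<comment> \<open>These two vertices lie opposite each other in the hexagon of \<open>y\<close>,
    at the indices belonging to the neighbour \<open>x\<close>.\<close>
  moreover have "{head (x, y), tail (y, x)} \<in> red_edges G"
    unfolding red_edges_eq using e by (intro image_eqI[of _ _ "(x, y)"]) simp_all
  ultimately show ?thesis
    by (metis empty_subsetI insert_subset)
qed

end

theorem proposition3:
  fixes G :: "'a ugraph" and idx :: "'a \<Rightarrow> 'a \<Rightarrow> 6" and M :: "('a \<times> 6) set set"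
  assumes "finite_simple_graph G" and "cubic G"
    and "hexagon_indexing G idx"
    and "blue_perfect_matching G idx M"
  shows "has_dual_loop G (encoded_rotation G idx M) \<longleftrightarrow>
    (\<exists>xs. cycle_in (sym_diff M (white_edges G idx)) xs \<and>
          (\<exists>r\<in>red_edges G. r \<subseteq> set xs))"
proof -
  interpret hexagon_matching G idx M
    using assms by unfold_locales
  show ?thesis
    using cycle_of_dual_loop dual_loop_of_cycle by blast
qed

end
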